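(* When agents communicate and coordinate their reports before perceiving the quality signals (so that they may coordinate on any, possibly asymmetric, profile of pure reporting strategies, without side-payments), no payment mechanism has honest reporting as its unique Nash equilibrium. That is, in the model described in the context, for every $N\ge 1$ and every payment scheme $\tau$, the profile in which all $N$ agents report honestly is not the unique pure-strategy Nash equilibrium.
   Context: $\Theta$ is a finite set of types with prior $\Pr[\theta]\ge0$, $\sum_\theta\Pr[\theta]=1$; each type $\theta$ has a probability $p_\theta=\Pr[\text{signal }1\mid\theta]\in[0,1]$, with $p_{\theta_1}\ne p_{\theta_2}$ for $\theta_1\neq\theta_2$. There are $N$ agents whose binary signals are, conditionally on the type $\theta$, independent and equal to $1$ with probability $p_\theta$ (and to $0$ otherwise). Both signals have positive prior probability: $\Pr[1]=\sum_\theta p_\theta\Pr[\theta]>0$ and $\Pr[0]=1-\Pr[1]>0$. A pure reporting strategy is a map $s:\{0,1\}\to\{0,1\}$ from the observed signal to the report (there are four: honest $s(o)=o$, lying $s(o)=1-o$, always $1$, always $0$). A strategy profile assigns a pure strategy $s_i$ to each agent $i=1,\dots,N$; profiles may be asymmetric. A payment scheme is a collection of reals $\tau(r,n)\ge0$, $r\in\{0,1\}$, $n\in\{0,\dots,N-1\}$: the amount paid to an agent who reports $r$ when exactly $n$ of the other $N-1$ agents report $1$. A profile $(s_i)$ is a Nash equilibrium if for every agent $i$ and every observation $o\in\{0,1\}$, the conditional expected payment to $i$, given that $i$ observed $o$ and that the other agents report according to their strategies $s_j$ ($j\neq i$), is at least as large when $i$ reports $s_i(o)$ as when $i$ reports $1-s_i(o)$.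 *)

theory Defs
  imports "HOL-Probability.Probability"
begin

text \<open>
  Signals and reports are Booleans, with \<^term>\<open>True\<close> for \<open>1\<close> and \<^term>\<open>False\<close> for \<open>0\<close>.
  The agents are \<open>1, \<dots>, N\<close>.
\<close>

type_synonym strategy = "bool \<Rightarrow> bool"

definition honest :: strategy where
  "honest obs = obs"

text \<open>
  Profiles are extensional functions (\<^const>\<open>undefined\<close> outside \<open>{1..N}\<close>), so that equality of
  profiles is equality of the strategies of the \<open>N\<close> agents.
\<close>

definition profiles :: "nat \<Rightarrow> (nat \<Rightarrow> strategy) set" where
  "profiles N = {1..N} \<rightarrow>\<^sub>E UNIV"

definition honest_profile :: "nat \<Rightarrow> nat \<Rightarrow> strategy" where
  "honest_profile N = restrict (\<lambda>i. honest) {1..N}"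

text \<open>Joint law of the type and of the signals \<open>\<sigma> 1, \<dots>, \<sigma> N\<close>, i.i.d. given the type.\<close>

definition signal_model :: "'a pmf \<Rightarrow> ('a \<Rightarrow> real) \<Rightarrow> nat \<Rightarrow> ('a \<times> (nat \<Rightarrow> bool)) pmf" where
  "signal_model prior p N =
     bind_pmf prior (\<lambda>\<theta>. map_pmf (Pair \<theta>) (Pi_pmf {1..N} False (\<lambda>_. bernoulli_pmf (p \<theta>))))"

definition positive_reports :: "nat \<Rightarrow> (nat \<Rightarrow> strategy) \<Rightarrow> nat \<Rightarrow> (nat \<Rightarrow> bool) \<Rightarrow> nat" where
  "positive_reports N s i \<sigma> = card {j \<in> {1..N} - {i}. s j (\<sigma> j)}"

text \<open>
  \<open>expected_payment prior p N \<tau> s i obs r\<close> is the conditional expectation of the payment to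
  agent \<open>i\<close> when reporting \<open>r\<close>, given that \<open>i\<close> observed \<open>obs\<close>.
\<close>

definition expected_payment ::
  "'a pmf \<Rightarrow> ('a \<Rightarrow> real) \<Rightarrow> nat \<Rightarrow> (bool \<Rightarrow> nat \<Rightarrow> real) \<Rightarrow> (nat \<Rightarrow> strategy) \<Rightarrow> nat \<Rightarrow> bool \<Rightarrow> bool \<Rightarrow> real"
where
  "expected_payment prior p N \<tau> s i obs r =
     measure_pmf.expectation
       (cond_pmf (signal_model prior p N) {(\<theta>, \<sigma>). \<sigma> i = obs})
       (\<lambda>(\<theta>, \<sigma>). \<tau> r (positive_reports N s i \<sigma>))"

definition nash_equilibrium ::
  "'a pmf \<Rightarrow> ('a \<Rightarrow> real) \<Rightarrow> nat \<Rightarrow> (bool \<Rightarrow> nat \<Rightarrow> real) \<Rightarrow> (nat \<Rightarrow> strategy) \<Rightarrow> bool"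
where
  "nash_equilibrium prior p N \<tau> s \<longleftrightarrow>
     s \<in> profiles N \<and>
     (\<forall>i\<in>{1..N}. \<forall>obs.
        expected_payment prior p N \<tau> s i obs (s i obs) \<ge>
        expected_payment prior p N \<tau> s i obs (\<not> s i obs))"

end

theory Submission
  imports Defs
begin

text \<open>
  If every agent ignores the signal, payments are deterministic. Let agents \<open>1, \<dots>, k\<close> always report
  \<open>1\<close> and the others always report \<open>0\<close>, where \<open>k\<close> is the least \<open>n\<close> with \<open>\<tau>(1,n) \<le> \<tau>(0,n)\<close>, or \<open>N\<close> if
  there is none below \<open>N\<close>. An agent reporting \<open>1\<close> faces \<open>k - 1\<close> others reporting \<open>1\<close>, where \<open>1\<close> pays
  more by minimality; an agent reporting \<open>0\<close> faces \<open>k\<close> of them, where \<open>0\<close> pays at least as much. So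
  this dishonest profile is always an equilibrium.
\<close>

definition threshold_profile :: "nat \<Rightarrow> nat \<Rightarrow> nat \<Rightarrow> strategy" where
  "threshold_profile N k = restrict (\<lambda>i _. i \<le> k) {1..N}"

lemma positive_reports_threshold:
  assumes "k \<le> N" "i \<in> {1..N}"
  shows "positive_reports N (threshold_profile N k) i \<sigma> = (if i \<le> k then k - 1 else k)"
proof -
  have "{j \<in> {1..N} - {i}. threshold_profile N k j (\<sigma> j)} = {1..k} - {i}"
    using assms(1) by (auto simp: threshold_profile_def)
  then show ?thesis
    using assms(2) by (simp add: positive_reports_def card_Diff_singleton_if)
qed

text \<open>The integrand does not depend on the signals, and a constant integrates to itself under
  any pmf, hence also under the conditional one.\<close>

lemma expected_payment_threshold:
  assumes "k \<le> N" "i \<in> {1..N}"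
  shows "expected_payment prior p N \<tau> (threshold_profile N k) i obs r =
    \<tau> r (if i \<le> k then k - 1 else k)"
  unfolding expected_payment_def positive_reports_threshold[OF assms] case_prod_unfold by simp

lemma nash_equilibrium_threshold:
  assumes "k \<le> N"
    and up: "k > 0 \<Longrightarrow> \<tau> False (k - 1) \<le> \<tau> True (k - 1)"
    and down: "k < N \<Longrightarrow> \<tau> True k \<le> \<tau> False k"
  shows "nash_equilibrium prior p N \<tau> (threshold_profile N k)"
  unfolding nash_equilibrium_def
proof (intro conjI ballI allI)
  show "threshold_profile N k \<in> profiles N"
    by (simp add: threshold_profile_def profiles_def)
  fix i obs
  assume i: "i \<in> {1..N}"
  then have s: "threshold_profile N k i obs \<longleftrightarrow> i \<le> k"
    by (simp add: threshold_profile_def)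
  show "expected_payment prior p N \<tau> (threshold_profile N k) i obs
          (\<not> threshold_profile N k i obs)
        \<le> expected_payment prior p N \<tau> (threshold_profile N k) i obs
          (threshold_profile N k i obs)"
    using i up down by (simp add: s expected_payment_threshold[OF assms(1) i])
qed

lemma exists_threshold_equilibrium:
  "\<exists>k. nash_equilibrium prior p N \<tau> (threshold_profile N k)"
proof -
  \<comment> \<open>The disjunct \<open>N \<le> n\<close> ensures that a least \<open>n\<close>
    exists and that it is at most \<open>N\<close>; below \<open>N\<close> only the payment
    comparison counts.\<close>
  define P where "P n \<longleftrightarrow> N \<le> n \<or> \<tau> True n \<le> \<tau> False n" for n
  define k where "k = (LEAST n. P n)"
  have "P N"
    by (simp add: P_def)
  then have "P k" "k \<le> N"
    unfolding k_def by (rule LeastI, rule Least_le)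
  moreover have "\<not> P (k - 1)" if "k > 0"
    unfolding k_def by (rule not_less_Least) (use that k_def in simp)
  ultimately have "nash_equilibrium prior p N \<tau> (threshold_profile N k)"
    by (intro nash_equilibrium_threshold) (auto simp: P_def)
  then show ?thesis ..
qed

lemma threshold_profile_neq_honest:
  assumes "N \<ge> 1"
  shows "threshold_profile N k \<noteq> honest_profile N"
proof
  assume "threshold_profile N k = honest_profile N"
  \<comment> \<open>Agent 1 exists as \<open>N \<ge> 1\<close>; its threshold report ignores
    \<open>obs\<close>, whereas an honest one varies with it.\<close>
  then have "threshold_profile N k 1 obs = honest_profile N 1 obs" for obs
    by simp
  from this[of True] this[of False] assms show False
    by (simp add: threshold_profile_def honest_profile_def honest_def)
qed

theorem proposition4p4:
  fixes \<Theta> :: "'a set" and prior :: "'a pmf" and p :: "'a \<Rightarrow> real"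
    and N :: nat and \<tau> :: "bool \<Rightarrow> nat \<Rightarrow> real"
  assumes "finite \<Theta>"
    and "set_pmf prior \<subseteq> \<Theta>"
    and "\<And>\<theta>. \<theta> \<in> \<Theta> \<Longrightarrow> p \<theta> \<in> {0..1}"
    and "inj_on p \<Theta>"
    and "(\<Sum>\<theta>\<in>\<Theta>. p \<theta> * pmf prior \<theta>) > 0"
    and "1 - (\<Sum>\<theta>\<in>\<Theta>. p \<theta> * pmf prior \<theta>) > 0"
    and "N \<ge> 1"
    and "\<And>r n. n \<le> N - 1 \<Longrightarrow> \<tau> r n \<ge> 0"
  shows "{s. nash_equilibrium prior p N \<tau> s} \<noteq> {honest_profile N}"
  using exists_threshold_equilibrium[of prior p N \<tau>] threshold_profile_neq_honest[OF assms(7)]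
  by blast

end
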